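(* Let $E$ be a nonzero reflexive real Banach space and let $S\colon E\rightrightarrows E^*$ and $T\colon E^*\rightrightarrows E$ be maximally monotone. Suppose $\pi_1\,\mathrm{dom}\,\varphi_T=E^*$ and there exists $w^*\in E^*$ with $E\times\{w^*\}\subset\mathrm{dom}\,\varphi_S$. Then (a) $(I_E+TS)(E)=E$, where $I_E$ is the identity of $E$; (b) $(I_{E^*}+ST)(E^* )=E^*$, where $I_{E^*}$ is the identity of $E^*$.
   Context: Since $E$ is reflexive, $T$ is regarded as a multifunction from $E^*$ into $E=E^{**}$, with graph $G(T)\subset E^*\times E$; monotonicity of $T$ means $\langle t_1-t_2,t_1^*-t_2^*\rangle\ge0$ for $(t_1^*,t_1),(t_2^*,t_2)\in G(T)$. Fitzpatrick functions: $\varphi_S(x,x^* ):=\sup_{(s,s^* )\in G(S)}[\langle x,s^*\rangle+\langle s,x^*\rangle-\langle s,s^*\rangle]$ on $E\times E^*$, and $\varphi_T(x^*,x):=\sup_{(t^*,t)\in G(T)}[\langle x,t^*\rangle+\langle t,x^*\rangle-\langle t,t^*\rangle]$ on $E^*\times E$; $\mathrm{dom}$ denotes the set where the function is finite, and $\pi_1$ is projection on the first coordinate. $TSx:=\bigcup_{y^*\in Sx}Ty^*$, $STx^*:=\bigcup_{y\in Tx^*}Sy$, $(I_E+TS)x:=\{x+z\colon z\in TSx\}$, and images of sets are unions of images of points. *)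

theory Defs
  imports "HOL-Analysis.Analysis"
begin

definition reflexive_space :: "'a::banach itself \<Rightarrow> bool" where
  "reflexive_space _ \<longleftrightarrow>
     (\<forall>\<Phi> :: ('a \<Rightarrow>\<^sub>L real) \<Rightarrow>\<^sub>L real. \<exists>x::'a. \<forall>f. blinfun_apply \<Phi> f = blinfun_apply f x)"

definition graphS :: "('a::banach \<Rightarrow> ('a \<Rightarrow>\<^sub>L real) set) \<Rightarrow> ('a \<times> ('a \<Rightarrow>\<^sub>L real)) set" where
  "graphS S = {(x, x'). x' \<in> S x}"

definition graphT :: "(('a::banach \<Rightarrow>\<^sub>L real) \<Rightarrow> 'a set) \<Rightarrow> (('a \<Rightarrow>\<^sub>L real) \<times> 'a) set" where
  "graphT T = {(x', x). x \<in> T x'}"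

definition monotone_setS :: "('a::banach \<times> ('a \<Rightarrow>\<^sub>L real)) set \<Rightarrow> bool" where
  "monotone_setS G \<longleftrightarrow> (\<forall>(s1, s1') \<in> G. \<forall>(s2, s2') \<in> G. blinfun_apply (s1' - s2') (s1 - s2) \<ge> 0)"

definition monotone_setT :: "(('a::banach \<Rightarrow>\<^sub>L real) \<times> 'a) set \<Rightarrow> bool" where
  "monotone_setT G \<longleftrightarrow> (\<forall>(t1', t1) \<in> G. \<forall>(t2', t2) \<in> G. blinfun_apply (t1' - t2') (t1 - t2) \<ge> 0)"

definition maximal_monotoneS :: "('a::banach \<Rightarrow> ('a \<Rightarrow>\<^sub>L real) set) \<Rightarrow> bool" where
  "maximal_monotoneS S \<longleftrightarrow> monotone_setS (graphS S) \<and>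
     (\<forall>G. monotone_setS G \<and> graphS S \<subseteq> G \<longrightarrow> G = graphS S)"

definition maximal_monotoneT :: "(('a::banach \<Rightarrow>\<^sub>L real) \<Rightarrow> 'a set) \<Rightarrow> bool" where
  "maximal_monotoneT T \<longleftrightarrow> monotone_setT (graphT T) \<and>
     (\<forall>G. monotone_setT G \<and> graphT T \<subseteq> G \<longrightarrow> G = graphT T)"

definition fitzS :: "('a::banach \<Rightarrow> ('a \<Rightarrow>\<^sub>L real) set) \<Rightarrow> 'a \<Rightarrow> ('a \<Rightarrow>\<^sub>L real) \<Rightarrow> ereal" where
  "fitzS S x x' = (SUP p \<in> graphS S. ereal (blinfun_apply (snd p) x + blinfun_apply x' (fst p)
                                          - blinfun_apply (snd p) (fst p)))"

definition fitzT :: "(('a::banach \<Rightarrow>\<^sub>L real) \<Rightarrow> 'a set) \<Rightarrow> ('a \<Rightarrow>\<^sub>L real) \<Rightarrow> 'a \<Rightarrow> ereal" where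
  "fitzT T x' x = (SUP p \<in> graphT T. ereal (blinfun_apply (fst p) x + blinfun_apply x' (snd p)
                                          - blinfun_apply (fst p) (snd p)))"

definition domS :: "('a::banach \<Rightarrow> ('a \<Rightarrow>\<^sub>L real) set) \<Rightarrow> ('a \<times> ('a \<Rightarrow>\<^sub>L real)) set" where
  "domS S = {(x, x'). \<bar>fitzS S x x'\<bar> \<noteq> \<infinity>}"

definition domT :: "(('a::banach \<Rightarrow>\<^sub>L real) \<Rightarrow> 'a set) \<Rightarrow> (('a \<Rightarrow>\<^sub>L real) \<times> 'a) set" where
  "domT T = {(x', x). \<bar>fitzT T x' x\<bar> \<noteq> \<infinity>}"

definition compTS :: "(('a::banach \<Rightarrow>\<^sub>L real) \<Rightarrow> 'a set) \<Rightarrow> ('a \<Rightarrow> ('a \<Rightarrow>\<^sub>L real) set) \<Rightarrow> 'a \<Rightarrow> 'a set" where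
  "compTS T S x = (\<Union>y' \<in> S x. T y')"

definition compST :: "('a::banach \<Rightarrow> ('a \<Rightarrow>\<^sub>L real) set) \<Rightarrow> (('a \<Rightarrow>\<^sub>L real) \<Rightarrow> 'a set) \<Rightarrow> ('a \<Rightarrow>\<^sub>L real) \<Rightarrow> ('a \<Rightarrow>\<^sub>L real) set" where
  "compST S T x' = (\<Union>y \<in> T x'. S y)"

end

(*
  Both assertions ask for a common point of G(S) and of a translate/reflection of the graph of
  T inverse: (x, y) in G(S) with (w - x, y) in G(T^-1) for (a), and with (x, w - y) in
  G(T^-1) for (b).  Since Fitzpatrick functions dominate the duality pairing, the sum of phi_S and
  of the correspondingly transformed phi_T is nonnegative, and the domain hypotheses say that the
  difference of the two domains is all of E x E^*.  Fenchel duality (Hahn-Banach, with continuity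
  of the separating functional supplied by a Baire category argument) and reflexivity then give a
  point of E x E^* at which the maximality of S and T forces membership in both graphs.
*)
theory Submission
  imports Defs
begin

section \<open>Fenchel duality for closed convex epigraphs\<close>

text \<open>Zorn's lemma gives a maximal subspace of \<open>'x \<times> real\<close> lying below
  \<open>Q\<close>, and a one-dimensional extension shows that it reaches every vector. Partial
  functionals are encoded as subspaces without demanding single-valuedness: this follows at the end,
  because a multivalued subspace would contain the whole line over 0.\<close>

lemma convex_dominated_linear_functional:
  fixes Q :: "('x::real_vector \<times> real) set"
  assumes Q: "convex Q" and dom: "\<And>u. \<exists>r. (u, r) \<in> Q" and pos: "\<And>r. (0, r) \<in> Q \<Longrightarrow> 0 \<le> r"
  obtains l where "linear l" "\<And>u r. (u, r) \<in> Q \<Longrightarrow> l u \<le> r"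
proof -
  define \<A> where "\<A> = {G :: ('x \<times> real) set. subspace G \<and> (\<forall>x a r. (x, a) \<in> G \<longrightarrow> (x, r) \<in> Q \<longrightarrow> a \<le> r)}"
  have "\<exists>M\<in>\<A>. \<forall>X\<in>\<A>. M \<subseteq> X \<longrightarrow> X = M"
  proof (rule subset_Zorn_nonempty)
    have "{0} \<in> \<A>"
      using pos by (auto simp: \<A>_def zero_prod_def[symmetric] prod_eq_iff)
    then show "\<A> \<noteq> {}" by blast
    fix \<C> assume ne: "\<C> \<noteq> {}" and ch: "subset.chain \<A> \<C>"
    have sub: "\<And>G. G \<in> \<C> \<Longrightarrow> G \<in> \<A>" and lin: "\<And>G H. G \<in> \<C> \<Longrightarrow> H \<in> \<C> \<Longrightarrow> G \<subseteq> H \<or> H \<subseteq> G"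
      using ch by (auto simp: subset_chain_def)
    have "subspace (\<Union>\<C>)"
    proof (rule subspaceI)
      show "0 \<in> \<Union>\<C>"
        using ne sub by (auto simp: \<A>_def dest: subspace_0)
      show "x + y \<in> \<Union>\<C>" if xy: "x \<in> \<Union>\<C>" "y \<in> \<Union>\<C>" for x y
      proof -
        obtain G H where "G \<in> \<C>" "H \<in> \<C>" "x \<in> G" "y \<in> H"
          using xy by blast
        then obtain K where "K \<in> \<C>" "x \<in> K" "y \<in> K"
          using lin by blast
        then show ?thesis
          using sub[of K] by (auto simp: \<A>_def intro: subspace_add)
      qed
      show "c *\<^sub>R x \<in> \<Union>\<C>" if "x \<in> \<Union>\<C>" for c x
        using that sub by (auto simp: \<A>_def intro: subspace_scale)
    qed
    then show "\<Union>\<C> \<in> \<A>"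
      using sub by (auto simp: \<A>_def)
  qed
  then obtain G where GA: "G \<in> \<A>" and max: "\<And>H. H \<in> \<A> \<Longrightarrow> G \<subseteq> H \<Longrightarrow> H = G"
    by blast
  have G: "subspace G" and le: "\<And>x a r. (x, a) \<in> G \<Longrightarrow> (x, r) \<in> Q \<Longrightarrow> a \<le> r"
    using GA by (auto simp: \<A>_def)
  have total: "\<exists>a. (v, a) \<in> G" for v
  proof -
    \<comment> \<open>A point of \<open>Q\<close> over \<open>m - s *\<^sub>R v\<close> forces the
      value at \<open>v\<close> to be at least \<open>(b - r) / s\<close>. \<open>D\<close> collects
      these lower bounds; \<open>sep\<close> shows that each is below every upper bound coming from
      the opposite side, so \<open>Sup D\<close> is an admissible value.\<close>
    define D where "D = {(b - r) / s | m b s r. (m, b) \<in> G \<and> s > 0 \<and> (m - s *\<^sub>R v, r) \<in> Q}"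
    define a where "a = Sup D"
    have sep: "(b - r) / s \<le> (r' - b') / t"
      if "(m, b) \<in> G" "s > 0" "(m - s *\<^sub>R v, r) \<in> Q" "(m', b') \<in> G" "t > 0" "(m' + t *\<^sub>R v, r') \<in> Q"
      for m b s r m' b' t r'
    proof -
      \<comment> \<open>These weights make the multiples of \<open>v\<close> cancel, so the combined
        point of \<open>Q\<close> lies over a vector where \<open>G\<close> is already
        dominated.\<close>
      define \<alpha> where "\<alpha> = t / (s + t)"
      define \<beta> where "\<beta> = s / (s + t)"
      have ab: "\<alpha> \<ge> 0" "\<beta> \<ge> 0" "\<alpha> + \<beta> = 1" "\<alpha> * s = \<beta> * t"
        using that by (auto simp: \<alpha>_def \<beta>_def add_divide_distrib[symmetric])
      have "\<alpha> *\<^sub>R (m - s *\<^sub>R v, r) + \<beta> *\<^sub>R (m' + t *\<^sub>R v, r') \<in> Q"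
        using Q that ab by (intro convexD) auto
      then have 1: "(\<alpha> *\<^sub>R m + \<beta> *\<^sub>R m', \<alpha> * r + \<beta> * r') \<in> Q"
        using ab by (simp add: algebra_simps)
      have "\<alpha> *\<^sub>R (m, b) + \<beta> *\<^sub>R (m', b') \<in> G"
        using G that by (intro subspace_add subspace_scale) auto
      then have "(\<alpha> *\<^sub>R m + \<beta> *\<^sub>R m', \<alpha> * b + \<beta> * b') \<in> G"
        by simp
      then have "\<alpha> * b + \<beta> * b' \<le> \<alpha> * r + \<beta> * r'"
        using le 1 by blast
      then have "(s + t) * (\<alpha> * b + \<beta> * b') \<le> (s + t) * (\<alpha> * r + \<beta> * r')"
        using that by (intro mult_left_mono) auto
      moreover have "(s + t) * \<alpha> = t" "(s + t) * \<beta> = s"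
        using that by (auto simp: \<alpha>_def \<beta>_def)
      ultimately have "t * b + s * b' \<le> t * r + s * r'"
        by (metis distrib_left mult.assoc)
      then show ?thesis
        using that by (simp add: field_simps)
    qed
    \<comment> \<open>Points of \<open>Q\<close> over \<open>v\<close> and \<open>- v\<close>,
      compared with the origin of \<open>G\<close>, make \<open>D\<close> bounded above and
      nonempty.\<close>
    obtain r1 where r1: "(0 + 1 *\<^sub>R v, r1) \<in> Q"
      using dom by blast
    obtain r2 where r2: "(0 - 1 *\<^sub>R v, r2) \<in> Q"
      using dom by blast
    have G0: "(0, 0) \<in> G"
      using subspace_0[OF G] by (simp add: zero_prod_def)
    have ne: "D \<noteq> {}"
      using G0 r2 zero_less_one unfolding D_def by blast
    have bdd: "bdd_above D"
      using sep[OF _ _ _ G0 zero_less_one r1] unfolding D_def bdd_above_def by blast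
    have dominated: "b + k * a \<le> r" if mem: "(m, b) \<in> G" "(m + k *\<^sub>R v, r) \<in> Q" for m b k r
    proof (cases k "0::real" rule: linorder_cases)
      case less
      then have "(b - r) / (- k) \<in> D"
        using mem unfolding D_def by (intro CollectI exI[of _ m] exI[of _ b] exI[of _ "- k"] exI[of _ r]) auto
      then have "(b - r) / (- k) \<le> a"
        unfolding a_def using bdd by (rule cSup_upper)
      then show ?thesis
        using less by (simp add: field_simps)
    next
      case equal
      then show ?thesis
        using mem le by auto
    next
      case greater
      have "a \<le> (r - b) / k"
        unfolding a_def using ne by (rule cSup_least) (use sep greater mem in \<open>auto simp: D_def\<close>)
      then show ?thesis
        using greater by (simp add: field_simps)
    qed
    define H where "H = span (insert (v, a) G)"
    have "G \<subseteq> H" and vH: "(v, a) \<in> H"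
      using span_superset unfolding H_def by blast+
    have "y \<le> r" if xH: "(x, y) \<in> H" and xQ: "(x, r) \<in> Q" for x y r
    proof -
      obtain k where "(x, y) - k *\<^sub>R (v, a) \<in> G"
        using xH unfolding H_def span_breakdown_eq span_eq_iff[THEN iffD2, OF G] by blast
      then show ?thesis
        using dominated[of "x - k *\<^sub>R v" "y - k * a" k r] xQ by simp
    qed
    then have "H \<in> \<A>"
      by (auto simp: \<A>_def H_def)
    then show ?thesis
      using max \<open>G \<subseteq> H\<close> vH by blast
  qed
  have unique: "a = b" if ab: "(v, a) \<in> G" "(v, b) \<in> G" for v a b
  proof (rule ccontr)
    assume neq: "a \<noteq> b"
    obtain r where r: "(0, r) \<in> Q"
      using dom by blast
    have "(v, a) - (v, b) \<in> G"
      using G ab by (intro subspace_diff)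
    \<comment> \<open>Scaling the vertical vector lifts it to height \<open>r + 1\<close>, above the
      point \<open>(0, r)\<close> of \<open>Q\<close>.\<close>
    then have "((r + 1) / (a - b)) *\<^sub>R (0, a - b) \<in> G"
      using G by (intro subspace_scale) simp_all
    then have "(0, r + 1) \<in> G"
      using neq by simp
    then show False
      using le r by fastforce
  qed
  define l where "l v = (THE a. (v, a) \<in> G)" for v
  have l: "(v, l v) \<in> G" for v
    unfolding l_def using total unique by (metis theI)
  have l_eq: "l v = a" if "(v, a) \<in> G" for v a
    using unique that l by blast
  have "linear l"
  proof (rule linearI)
    show "l (x + y) = l x + l y" for x y
      using subspace_add[OF G l l] by (intro l_eq) simp
    show "l (c *\<^sub>R x) = c *\<^sub>R l x" for c x
      using subspace_scale[OF G l, of c] by (intro l_eq) simp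
  qed
  then show thesis
    using le l that by blast
qed

section \<open>Continuity of the functional by Baire category\<close>

text \<open>Linearity moves the upper bound from \<open>c\<close> to the origin, homogeneity spreads
  it to all vectors, and applying it to \<open>- x\<close> makes it two-sided.\<close>

lemma linear_bounded_above_on_ball:
  fixes l :: "'x::real_normed_vector \<Rightarrow> real"
  assumes l: "linear l" and "r > 0" and le: "\<And>u. u \<in> ball c r \<Longrightarrow> l u \<le> N"
  shows "bounded_linear l"
proof -
  interpret l: linear l by fact
  define M where "M = N - l c"
  have small: "l h \<le> M" if "norm h < r" for h
    using le[of "c + h"] that by (simp add: l.add M_def dist_norm)
  have M: "M \<ge> 0"
    using small[of 0] \<open>r > 0\<close> by (simp add: l.zero)
  have one: "l x \<le> norm x * (2 * M / r)" for x
  proof (cases "x = 0")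
    case False
    define t where "t = r / (2 * norm x)"
    have t: "t > 0" "norm (t *\<^sub>R x) < r"
      using False \<open>r > 0\<close> by (auto simp: t_def)
    have "t * l x \<le> M"
      using small[OF t(2)] by (simp add: l.scaleR)
    then show ?thesis
      using False \<open>r > 0\<close> by (simp add: t_def field_simps)
  qed (simp add: l.zero)
  have "norm (l x) \<le> norm x * (2 * M / r)" for x
    using one[of x] one[of "- x"] by (auto simp: l.neg abs_le_iff)
  then show ?thesis
    by (intro bounded_linear_intro[where K = "2 * M / r"]) (simp_all add: l.add l.scaleR)
qed

text \<open>The successive approximation argument of the open mapping theorem.\<close>

lemma closed_convex_image_contains_ball:
  fixes L :: "'y::banach \<Rightarrow> 'x::real_normed_vector"
  assumes L: "bounded_linear L" and B: "convex B" "closed B" "bounded B"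
    and "r > 0" and dense: "ball c r \<subseteq> closure (L ` B)"
  shows "ball c (r / 2) \<subseteq> L ` B"
proof
  interpret L: bounded_linear L by fact
  fix u assume u: "u \<in> ball c (r / 2)"
  have "\<exists>y\<in>B. dist (L y) w < r / 2 ^ (k + 2)" if "w \<in> ball c r" for w and k :: nat
  proof -
    have "w \<in> closure (L ` B)" "r / 2 ^ (k + 2) > 0"
      using that dense \<open>r > 0\<close> by auto
    then show ?thesis
      unfolding closure_approachable by blast
  qed
  then have "\<exists>y. \<forall>k w. w \<in> ball c r \<longrightarrow> y k w \<in> B \<and> dist (L (y k w)) w < r / 2 ^ (k + 2)"
    by (intro choice allI) blast
  then obtain y where yB: "\<And>w k. w \<in> ball c r \<Longrightarrow> y k w \<in> B"
    and y: "\<And>w k. w \<in> ball c r \<Longrightarrow> dist (L (y k w)) w < r / 2 ^ (k + 2)"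
    by blast
  \<comment> \<open>\<open>U k\<close> is the remainder after \<open>k\<close> approximations,
    magnified by \<open>2 ^ k\<close>: \<open>u\<close> equals \<open>L (P k)\<close> plus
    \<open>(1/2) ^ k *\<^sub>R U k\<close>, with \<open>P\<close> as defined below.\<close>
  define U where "U = rec_nat u (\<lambda>k w. 2 *\<^sub>R w - L (y k w))"
  have U0: "U 0 = u" and US: "\<And>k. U (Suc k) = 2 *\<^sub>R U k - L (y k (U k))"
    by (simp_all add: U_def)
  \<comment> \<open>The tolerance \<open>r / 2 ^ (k + 2)\<close> uses up exactly half of the slack
    \<open>r / 2 ^ (k + 1)\<close>, so the remainders never leave \<open>ball c r\<close>. The
    initial slack \<open>r / 2\<close> is the reason for halving the radius.\<close>
  have Ubound: "dist c (U k) < r - r / 2 ^ (k + 1)" for k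
  proof (induction k)
    case 0
    then show ?case
      using u by (simp add: U0)
  next
    case (Suc k)
    have "r / 2 ^ (k + 1) > 0"
      using \<open>r > 0\<close> by simp
    then have "U k \<in> ball c r"
      using Suc by simp
    then have d: "dist (L (y k (U k))) (U k) < r / 2 ^ (k + 2)"
      by (rule y)
    have "dist c (U (Suc k)) \<le> dist c (U k) + dist (U k) (U (Suc k))"
      by (rule dist_triangle)
    also have "dist (U k) (U (Suc k)) = dist (L (y k (U k))) (U k)"
      by (simp add: US dist_norm scaleR_2)
    finally have "dist c (U (Suc k)) \<le> dist c (U k) + dist (L (y k (U k))) (U k)" .
    moreover have "r / 2 ^ (k + 1) = 2 * (r / 2 ^ (k + 2))" "r / 2 ^ (Suc k + 1) = r / 2 ^ (k + 2)"
      by simp_all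
    ultimately show ?case
      using d Suc by linarith
  qed
  have Uball: "U k \<in> ball c r" for k
    using Ubound[of k] \<open>r > 0\<close> by (smt (verit) mem_ball divide_pos_pos zero_less_power)
  define Y where "Y k = y k (U k)" for k
  have YB: "Y k \<in> B" for k
    unfolding Y_def using yB Uball by blast
  define P where "P m = (\<Sum>k<m. (1/2) ^ Suc k *\<^sub>R Y k)" for m
  \<comment> \<open>The weights in \<open>P m\<close> add up to \<open>1 - (1/2) ^ m\<close>; giving
    the missing weight to a point of \<open>B\<close> completes a convex combination. The filler
    vanishes in the limit, so closedness puts \<open>p\<close> in \<open>B\<close>.\<close>
  have comb: "P m + (1/2) ^ m *\<^sub>R z \<in> B" if "z \<in> B" for m z
    using that
  proof (induction m arbitrary: z)
    case (Suc m)
    have "(1/2) *\<^sub>R Y m + (1/2) *\<^sub>R z \<in> B"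
      using B(1) YB Suc.prems by (intro convexD) auto
    from Suc.IH[OF this] show ?case
      by (simp add: P_def algebra_simps)
  qed (simp add: P_def)
  have LP: "L (P m) = u - (1/2) ^ m *\<^sub>R U m" for m
  proof (induction m)
    case (Suc m)
    have "L (P (Suc m)) = L (P m) + (1/2) ^ Suc m *\<^sub>R L (Y m)"
      by (simp add: P_def L.add L.scaleR)
    then show ?case
      by (simp add: Suc US Y_def algebra_simps)
  qed (simp add: P_def L.zero U0)
  obtain M where M: "\<And>x. x \<in> B \<Longrightarrow> norm x \<le> M"
    using B(3) by (auto simp: bounded_iff)
  have half: "(\<lambda>m. (1/2 :: real) ^ m) \<longlonglongrightarrow> 0"
    by (rule LIMSEQ_power_zero) simp
  have "summable (\<lambda>k. (1/2) ^ Suc k *\<^sub>R Y k)"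
  proof (rule summable_comparison_test')
    show "summable (\<lambda>k. (1/2) ^ Suc k * M)"
      by (intro summable_mult2) (simp add: summable_geometric)
    show "norm ((1/2) ^ Suc k *\<^sub>R Y k) \<le> (1/2) ^ Suc k * M" if "k \<ge> 0" for k
      using M[OF YB[of k]] by (simp add: mult_left_mono)
  qed
  then obtain p where P: "P \<longlonglongrightarrow> p"
    unfolding P_def by (auto simp: summable_def sums_def)
  have "(\<lambda>m. P m + (1/2) ^ m *\<^sub>R Y 0) \<longlonglongrightarrow> p + 0 *\<^sub>R Y 0"
    by (intro tendsto_intros P half)
  then have lim: "(\<lambda>m. P m + (1/2) ^ m *\<^sub>R Y 0) \<longlonglongrightarrow> p"
    by simp
  have "p \<in> B"
    by (rule closed_sequentially[OF B(2) _ lim]) (rule comb[OF YB])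
  have "(\<lambda>m. (1/2) ^ m *\<^sub>R U m) \<longlonglongrightarrow> 0"
  proof (rule Lim_null_comparison)
    have "norm (U k) \<le> norm c + r" for k
      using Uball[of k] norm_triangle_sub[of "U k" c] by (simp add: dist_norm norm_minus_commute)
    then show "\<forall>\<^sub>F m in sequentially. norm ((1/2) ^ m *\<^sub>R U m) \<le> (1/2) ^ m * (norm c + r)"
      by (intro always_eventually allI) (simp add: mult_left_mono)
    show "(\<lambda>m. (1/2) ^ m * (norm c + r)) \<longlonglongrightarrow> 0"
      by (rule tendsto_mult_left_zero[OF half])
  qed
  then have "(\<lambda>m. L (P m)) \<longlonglongrightarrow> u - 0"
    unfolding LP by (intro tendsto_intros)
  moreover have "(\<lambda>m. L (P m)) \<longlonglongrightarrow> L p"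
    by (rule L.tendsto[OF P])
  ultimately have "u = L p"
    using LIMSEQ_unique by fastforce
  then show "u \<in> L ` B"
    using \<open>p \<in> B\<close> by blast
qed

text \<open>By Baire's theorem the closures cannot all have empty interior.\<close>

lemma countable_cover_closure_contains_ball:
  fixes C :: "nat \<Rightarrow> 'x::banach set"
  assumes cover: "(\<Union>n. C n) = UNIV"
  obtains n c r where "r > 0" "ball c r \<subseteq> closure (C n)"
proof -
  have "\<exists>n. interior (closure (C n)) \<noteq> {}"
  proof (rule ccontr)
    assume "\<not> ?thesis"
    then have "euclidean interior_of \<Union>(range (\<lambda>n. closure (C n))) = {}"
      by (intro Baire_category_alt) (auto simp: completely_metrizable_space_euclidean)
    moreover have "(\<Union>n. closure (C n)) = UNIV"
      using cover closure_subset by blast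
    ultimately show False
      by simp
  qed
  then obtain n c where "c \<in> interior (closure (C n))"
    by blast
  then obtain r where "r > 0" "ball c r \<subseteq> closure (C n)"
    by (auto simp: mem_interior)
  then show thesis
    using that by blast
qed

section \<open>Fenchel duality\<close>

text \<open>The pairs \<open>(x - y, r + s)\<close> form a convex set that meets every fibre by
  \<open>dom\<close> and is nonnegative over 0 by \<open>pos\<close>, so it dominates a linear
  functional. For continuity, the differences from bounded parts of \<open>F \<times> K\<close>
  cover the space; one part therefore yields a whole ball, on which the heights bound
  \<open>l\<close>.\<close>

theorem fenchel_duality_epigraphs:
  fixes F K :: "('x::banach \<times> real) set"
  assumes F: "convex F" "closed F" and K: "convex K" "closed K"
    and dom: "\<And>u. \<exists>x r y s. (x, r) \<in> F \<and> (y, s) \<in> K \<and> u = x - y"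
    and pos: "\<And>x r s. (x, r) \<in> F \<Longrightarrow> (x, s) \<in> K \<Longrightarrow> 0 \<le> r + s"
  obtains l where "bounded_linear l"
    "\<And>x r y s. (x, r) \<in> F \<Longrightarrow> (y, s) \<in> K \<Longrightarrow> l (x - y) \<le> r + s"
proof -
  define V where "V p = (fst (fst p) - fst (snd p), snd (fst p) + snd (snd p))"
    for p :: "('x \<times> real) \<times> ('x \<times> real)"
  define L where "L p = fst (fst p) - fst (snd p)" for p :: "('x \<times> real) \<times> ('x \<times> real)"
  have linV: "linear V"
    by (rule linearI) (auto simp: V_def algebra_simps)
  have linL: "bounded_linear L"
    unfolding L_def by (intro bounded_linear_intros)
  have "convex (V ` (F \<times> K))"
    by (intro convex_linear_image linV convex_Times F K)
  moreover have "\<exists>r. (u, r) \<in> V ` (F \<times> K)" for u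
    using dom[of u] by (force simp: V_def image_def)
  moreover have "0 \<le> r" if "(0, r) \<in> V ` (F \<times> K)" for r
    using that pos by (auto simp: V_def)
  ultimately obtain l where l: "linear l" "\<And>u r. (u, r) \<in> V ` (F \<times> K) \<Longrightarrow> l u \<le> r"
    using convex_dominated_linear_functional[of "V ` (F \<times> K)"] by blast
  have le: "l (x - y) \<le> r + s" if "(x, r) \<in> F" "(y, s) \<in> K" for x r y s
    by (rule l(2)) (use that in \<open>force simp: V_def image_def\<close>)
  \<comment> \<open>Truncation provides the boundedness needed for successive approximation and also
    bounds the heights \<open>r\<close> and \<open>s\<close> by \<open>n\<close>.\<close>
  define B where "B n = (F \<times> K) \<inter> cball 0 (real n)" for n
  have B: "convex (B n)" "closed (B n)" "bounded (B n)" for n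
    unfolding B_def by (intro convex_Int convex_Times closed_Int closed_Times F K bounded_Int disjI2
      convex_cball closed_cball bounded_cball)+
  have "(\<Union>n. L ` B n) = UNIV"
  proof -
    have "\<exists>n. u \<in> L ` B n" for u
    proof -
      obtain p where p: "p \<in> F \<times> K" "L p = u"
        using dom[of u] by (force simp: L_def)
      obtain n where "norm p \<le> real n"
        using real_arch_simple by blast
      then have "p \<in> B n"
        using p by (simp add: B_def)
      then show ?thesis
        using p by blast
    qed
    then show ?thesis by blast
  qed
  then obtain n c r where r: "r > 0" "ball c r \<subseteq> closure (L ` B n)"
    by (rule countable_cover_closure_contains_ball)
  then have sub: "ball c (r / 2) \<subseteq> L ` B n"
    by (intro closed_convex_image_contains_ball linL B)
  have "l u \<le> 2 * real n" if u: "u \<in> ball c (r / 2)" for u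
  proof -
    obtain x a y b where xy: "((x, a), (y, b)) \<in> B n" "u = x - y"
    proof -
      obtain p where "p \<in> B n" "u = L p"
        using u sub by blast
      then show thesis
        using that[of "fst (fst p)" "snd (fst p)" "fst (snd p)" "snd (snd p)"] by (simp add: L_def)
    qed
    have "norm ((x, a), (y, b)) \<le> real n"
      using xy by (simp add: B_def)
    then have "\<bar>a\<bar> \<le> real n" "\<bar>b\<bar> \<le> real n"
      using norm_snd_le[of a x] norm_snd_le[of b y] norm_fst_le[of "(x, a)" "(y, b)"]
        norm_snd_le[of "(y, b)" "(x, a)"] by auto
    then show ?thesis
      using le[of x a y b] xy by (auto simp: B_def)
  qed
  then have "bounded_linear l"
    using l(1) r(1) by (intro linear_bounded_above_on_ball[of l "r / 2" c]) auto
  then show thesis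
    using le that by blast
qed

section \<open>Fitzpatrick functions of maximal monotone graphs\<close>

text \<open>Maximality in polar form: the graph consists of all pairs monotonically related to it.
  Ordering pairs as point and functional lets the graph of \<open>S\<close> and the converse of the
  graph of \<open>T\<close> be treated alike.\<close>

definition max_monotone_graph :: "('a::banach \<times> ('a \<Rightarrow>\<^sub>L real)) set \<Rightarrow> bool" where
  "max_monotone_graph G \<longleftrightarrow>
     (\<forall>x x'. (x, x') \<in> G \<longleftrightarrow> (\<forall>(s, s') \<in> G. 0 \<le> blinfun_apply (x' - s') (x - s)))"

text \<open>The epigraph of the Fitzpatrick function, written with real inequalities so that the
  duality argument avoids extended reals.\<close>

definition fitz_epi :: "('a::banach \<times> ('a \<Rightarrow>\<^sub>L real)) set \<Rightarrow> (('a \<times> ('a \<Rightarrow>\<^sub>L real)) \<times> real) set" where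
  "fitz_epi G = {((x, x'), r). \<forall>(s, s') \<in> G.
     blinfun_apply s' x + blinfun_apply x' s - blinfun_apply s' s \<le> r}"

text \<open>Adjoining a pair that is monotonically related to the graph keeps it monotone, so by
  maximality the pair was already there.\<close>

lemma max_monotone_graphS:
  assumes "maximal_monotoneS S"
  shows "max_monotone_graph (graphS S)"
  unfolding max_monotone_graph_def
proof (intro allI iffI)
  have mono: "monotone_setS (graphS S)"
    and max: "\<And>G. monotone_setS G \<Longrightarrow> graphS S \<subseteq> G \<Longrightarrow> G = graphS S"
    using assms by (auto simp: maximal_monotoneS_def)
  fix x x'
  show "\<forall>(s, s') \<in> graphS S. 0 \<le> blinfun_apply (x' - s') (x - s)" if "(x, x') \<in> graphS S"
    using that mono unfolding monotone_setS_def by fast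
  assume rel: "\<forall>(s, s') \<in> graphS S. 0 \<le> blinfun_apply (x' - s') (x - s)"
  have swap: "blinfun_apply (s' - x') (s - x) = blinfun_apply (x' - s') (x - s)" for s s'
    by (simp add: blinfun.diff_left blinfun.diff_right)
  have "monotone_setS (insert (x, x') (graphS S))"
    using rel mono unfolding monotone_setS_def by (force simp: swap)
  from max[OF this] show "(x, x') \<in> graphS S"
    by blast
qed

lemma max_monotone_graphT:
  assumes "maximal_monotoneT T"
  shows "max_monotone_graph ((graphT T)\<inverse>)"
  unfolding max_monotone_graph_def
proof (intro allI iffI)
  have mono: "monotone_setT (graphT T)"
    and max: "\<And>G. monotone_setT G \<Longrightarrow> graphT T \<subseteq> G \<Longrightarrow> G = graphT T"
    using assms by (auto simp: maximal_monotoneT_def)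
  fix x x'
  show "\<forall>(s, s') \<in> (graphT T)\<inverse>. 0 \<le> blinfun_apply (x' - s') (x - s)" if "(x, x') \<in> (graphT T)\<inverse>"
    using that mono unfolding monotone_setT_def by fast
  assume rel: "\<forall>(s, s') \<in> (graphT T)\<inverse>. 0 \<le> blinfun_apply (x' - s') (x - s)"
  have swap: "blinfun_apply (s' - x') (s - x) = blinfun_apply (x' - s') (x - s)" for s s'
    by (simp add: blinfun.diff_left blinfun.diff_right)
  have "monotone_setT (insert (x', x) (graphT T))"
    using rel mono unfolding monotone_setT_def by (force simp: swap)
  from max[OF this] show "(x, x') \<in> (graphT T)\<inverse>"
    by blast
qed

lemma fitz_epiS_iff: "((x, x'), r) \<in> fitz_epi (graphS S) \<longleftrightarrow> fitzS S x x' \<le> ereal r"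
  by (force simp: fitz_epi_def fitzS_def SUP_le_iff)

lemma fitz_epiT_iff: "((x, x'), r) \<in> fitz_epi ((graphT T)\<inverse>) \<longleftrightarrow> fitzT T x' x \<le> ereal r"
  by (force simp: fitz_epi_def fitzT_def SUP_le_iff add.commute)

lemma finite_ereal_le: "\<bar>e\<bar> \<noteq> \<infinity> \<Longrightarrow> \<exists>r. e \<le> ereal r"
  by (cases e) auto

text \<open>Each graph element contributes one closed half-space; convexity and closedness of the
  epigraph are read off from this.\<close>

lemma fitz_epi_Inter:
  "fitz_epi G = (\<Inter>(s, s') \<in> G. {q. blinfun_apply s' (fst (fst q)) + blinfun_apply (snd (fst q)) s - snd q
     \<le> blinfun_apply s' s})"
  by (fastforce simp: fitz_epi_def algebra_simps)

lemma convex_fitz_epi: "convex (fitz_epi G)"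
proof -
  have "convex {q. blinfun_apply s' (fst (fst q)) + blinfun_apply (snd (fst q)) s - snd q
     \<le> blinfun_apply s' s}" (is "convex {q. ?f q \<le> _}")
    for s and s' :: "'a \<Rightarrow>\<^sub>L real"
  proof -
    have "linear ?f"
      by (rule linearI) (auto simp: blinfun.bilinear_simps algebra_simps)
    then have "convex (?f -` {..blinfun_apply s' s})"
      by (intro convex_linear_vimage) auto
    then show ?thesis
      by (simp add: vimage_def)
  qed
  then show ?thesis
    unfolding fitz_epi_Inter by (intro convex_INT) auto
qed

lemma convex_translation_vimage:
  fixes S :: "'x::real_vector set"
  assumes "convex S"
  shows "convex ((\<lambda>x. a + x) -` S)"
proof -
  have "(\<lambda>x. a + x) -` S = (\<lambda>x. - a + x) ` S"
    by (force simp: image_iff)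
  then show ?thesis
    using assms by (simp only: convex_translation_eq)
qed

lemma closed_fitz_epi: "closed (fitz_epi G)"
  unfolding fitz_epi_Inter
  by (intro closed_INT ballI) (auto intro!: closed_Collect_le continuous_intros simp: split_beta)

context
  fixes G :: "('a::banach \<times> ('a \<Rightarrow>\<^sub>L real)) set"
  assumes G: "max_monotone_graph G"
begin

text \<open>If \<open>r\<close> were below the pairing, \<open>(x, x')\<close> would be strictly
  monotonically related to all of \<open>G\<close>, hence a member of \<open>G\<close> by
  maximality, and then strictly related to itself.\<close>

lemma fitz_epi_ge:
  assumes epi: "((x, x'), r) \<in> fitz_epi G"
  shows "blinfun_apply x' x \<le> r"
proof (rule ccontr)
  assume less: "\<not> ?thesis"
  have gt: "0 < blinfun_apply (x' - s') (x - s)" if "(s, s') \<in> G" for s s'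
  proof -
    have "blinfun_apply s' x + blinfun_apply x' s - blinfun_apply s' s \<le> r"
      using epi that by (auto simp: fitz_epi_def)
    then show ?thesis
      using less by (simp add: blinfun.bilinear_simps)
  qed
  then have "(x, x') \<in> G"
    using G by (auto simp: max_monotone_graph_def intro: less_imp_le)
  from gt[OF this] show False
    by (simp add: blinfun.bilinear_simps)
qed

text \<open>The defining inequality at height \<open>blinfun_apply s' s\<close> rearranges to
  monotonicity of \<open>G\<close> between \<open>(s, s')\<close> and an arbitrary
  \<open>(t, t')\<close>.\<close>

lemma graph_in_fitz_epi:
  assumes "(s, s') \<in> G"
  shows "((s, s'), blinfun_apply s' s) \<in> fitz_epi G"
proof -
  have "0 \<le> blinfun_apply (s' - t') (s - t)" if "(t, t') \<in> G" for t t'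
    using G assms that unfolding max_monotone_graph_def by fast
  then show ?thesis
    by (force simp: fitz_epi_def blinfun.bilinear_simps)
qed

lemma not_in_graphE:
  assumes "(x, x') \<notin> G"
  obtains s s' where "(s, s') \<in> G" "blinfun_apply (x' - s') (x - s) < 0"
  using G assms unfolding max_monotone_graph_def by fastforce

end

section \<open>Duality on the product of a reflexive space and its dual\<close>

text \<open>Restriction to the two factors gives an element of the dual and one of the bidual;
  reflexivity turns the latter into a point \<open>z\<close>.\<close>

lemma reflexive_dual_prod:
  fixes l :: "'a::banach \<times> ('a \<Rightarrow>\<^sub>L real) \<Rightarrow> real"
  assumes refl: "reflexive_space TYPE('a)" and l: "bounded_linear l"
  obtains z z' where "\<And>x x'. l (x, x') = blinfun_apply z' x + blinfun_apply x' z"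
proof -
  interpret l: bounded_linear l by fact
  have 1: "bounded_linear (\<lambda>x. l (x, 0))" "bounded_linear (\<lambda>x'. l (0, x'))"
    by (rule bounded_linear_compose[OF l], intro bounded_linear_intros)+
  obtain z where z: "\<And>x'. l (0, x') = blinfun_apply x' z"
    using refl unfolding reflexive_space_def by (metis 1(2) bounded_linear_Blinfun_apply)
  have "l (x, x') = blinfun_apply (Blinfun (\<lambda>x. l (x, 0))) x + blinfun_apply x' z" for x x'
    using l.add[of "(x, 0)" "(0, x')"] by (simp add: z bounded_linear_Blinfun_apply[OF 1(1)])
  then show thesis
    using that by blast
qed

lemma reflexive_fenchel_duality:
  fixes F K :: "(('a::banach \<times> ('a \<Rightarrow>\<^sub>L real)) \<times> real) set"
  assumes "reflexive_space TYPE('a)"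
    and "convex F" "closed F" "convex K" "closed K"
    and "\<And>u u'. \<exists>x x' r y y' s. ((x, x'), r) \<in> F \<and> ((y, y'), s) \<in> K \<and> u = x - y \<and> u' = x' - y'"
    and "\<And>x x' r s. ((x, x'), r) \<in> F \<Longrightarrow> ((x, x'), s) \<in> K \<Longrightarrow> 0 \<le> r + s"
  obtains z z' where "\<And>x x' r y y' s. ((x, x'), r) \<in> F \<Longrightarrow> ((y, y'), s) \<in> K \<Longrightarrow>
    blinfun_apply z' (x - y) + blinfun_apply (x' - y') z \<le> r + s"
proof -
  have "\<exists>x r y s. (x, r) \<in> F \<and> (y, s) \<in> K \<and> u = x - y" for u
    using assms(6)[of "fst u" "snd u"] by (metis diff_Pair prod.collapse)
  moreover have "0 \<le> r + s" if "(x, r) \<in> F" "(x, s) \<in> K" for x r s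
    using assms(7)[of "fst x" "snd x"] that by simp
  ultimately obtain l where l: "bounded_linear l"
    "\<And>x r y s. (x, r) \<in> F \<Longrightarrow> (y, s) \<in> K \<Longrightarrow> l (x - y) \<le> r + s"
    using fenchel_duality_epigraphs[of F K] assms(2-5) by blast
  obtain z z' where "\<And>x x'. l (x, x') = blinfun_apply z' x + blinfun_apply x' z"
    by (rule reflexive_dual_prod[OF assms(1) l(1)]) (rule that)
  then have "blinfun_apply z' (x - y) + blinfun_apply (x' - y') z \<le> r + s"
    if "((x, x'), r) \<in> F" "((y, y'), s) \<in> K" for x x' r y y' s
    using l(2)[OF that] by simp
  then show thesis
    by (rule that)
qed

section \<open>Common points of one graph and a reflection of the other\<close>

text \<open>Fenchel duality is applied to the Fitzpatrick function of \<open>A\<close> and to that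
  of \<open>B\<close> at \<open>(w - y, y')\<close> minus \<open>blinfun_apply y' w\<close>. The
  dual solution \<open>(z, z')\<close> is itself the common point.\<close>

lemma graph_meets_reflection:
  fixes A B :: "('a::banach \<times> ('a \<Rightarrow>\<^sub>L real)) set"
  assumes refl: "reflexive_space TYPE('a)"
    and A: "max_monotone_graph A" and B: "max_monotone_graph B"
    and domA: "\<And>x. \<exists>r. ((x, w'), r) \<in> fitz_epi A"
    and domB: "\<And>x'. \<exists>x r. ((x, x'), r) \<in> fitz_epi B"
  shows "\<exists>z z'. (z, z') \<in> A \<and> (w - z, z') \<in> B"
proof -
  \<comment> \<open>The linear part of the affine change of variables in \<open>K\<close>;
    translation by \<open>((w, 0), 0)\<close> supplies the rest.\<close>
  define \<sigma> where "\<sigma> q = ((- fst (fst q), snd (fst q)), snd q + blinfun_apply (snd (fst q)) w)"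
    for q :: "('a \<times> ('a \<Rightarrow>\<^sub>L real)) \<times> real"
  define K where "K = {((y, y'), s). ((w - y, y'), s + blinfun_apply y' w) \<in> fitz_epi B}"
  have lin: "linear \<sigma>"
    by (rule linearI) (auto simp: \<sigma>_def blinfun.bilinear_simps algebra_simps)
  have cont: "continuous_on UNIV \<sigma>"
    unfolding \<sigma>_def by (intro continuous_intros)
  have K_eq: "K = \<sigma> -` ((\<lambda>q. ((w, 0), 0) + q) -` fitz_epi B)"
    by (auto simp: K_def \<sigma>_def)
  have convK: "convex K"
    unfolding K_eq
    by (intro convex_linear_vimage lin convex_translation_vimage convex_fitz_epi)
  have closK: "closed K"
    unfolding K_eq
    by (intro closed_vimage closed_fitz_epi cont continuous_intros)
  have domK: "\<exists>x x' r y y' s. ((x, x'), r) \<in> fitz_epi A \<and> ((y, y'), s) \<in> K \<and> u = x - y \<and> u' = x' - y'"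
    for u u'
  proof -
    \<comment> \<open>The functional in \<open>A\<close> is pinned at \<open>w'\<close>, so
      \<open>B\<close> must absorb \<open>u'\<close>; the point in \<open>A\<close> is free and
      absorbs \<open>u\<close>.\<close>
    obtain b s where b: "((b, w' - u'), s) \<in> fitz_epi B"
      using domB by blast
    obtain r where "((u + (w - b), w'), r) \<in> fitz_epi A"
      using domA by blast
    moreover have "((w - b, w' - u'), s - blinfun_apply (w' - u') w) \<in> K"
      using b by (simp add: K_def)
    ultimately show ?thesis
      by (intro exI conjI) (assumption | simp)+
  qed
  have posK: "0 \<le> r + s" if "((x, x'), r) \<in> fitz_epi A" "((x, x'), s) \<in> K" for x x' r s
    using fitz_epi_ge[OF A that(1)] fitz_epi_ge[OF B, of "w - x" x' "s + blinfun_apply x' w"] that(2)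
    by (simp add: K_def blinfun.bilinear_simps)
  obtain z z' where z: "\<And>x x' r y y' s. ((x, x'), r) \<in> fitz_epi A \<Longrightarrow> ((y, y'), s) \<in> K \<Longrightarrow>
      blinfun_apply z' (x - y) + blinfun_apply (x' - y') z \<le> r + s"
    by (rule reflexive_fenchel_duality[OF refl convex_fitz_epi closed_fitz_epi convK closK domK])
      (erule (1) posK, rule that, blast)
  \<comment> \<open>Evaluating the dual inequality at graph elements, where the heights are the
    pairings, leaves a sum of two monotonicity expressions.\<close>
  have key: "0 \<le> blinfun_apply (z' - s') (z - s) + blinfun_apply (z' - t') (w - z - t)"
    if "(s, s') \<in> A" "(t, t') \<in> B" for s s' t t'
  proof -
    have "((w - t, t'), blinfun_apply t' t - blinfun_apply t' w) \<in> K"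
      using graph_in_fitz_epi[OF B that(2)] by (simp add: K_def)
    from z[OF graph_in_fitz_epi[OF A that(1)] this] show ?thesis
      by (simp add: blinfun.bilinear_simps)
  qed
  have "(z, z') \<in> A"
  proof (rule ccontr)
    assume "(z, z') \<notin> A"
    then obtain s s' where s: "(s, s') \<in> A" "blinfun_apply (z' - s') (z - s) < 0"
      by (rule not_in_graphE[OF A])
    \<comment> \<open>A negative first term makes the second positive on all of \<open>B\<close>, so
      \<open>(w - z, z')\<close> lies in \<open>B\<close> by maximality; at that very element the
      second term is 0.\<close>
    then have pos: "0 < blinfun_apply (z' - t') (w - z - t)" if "(t, t') \<in> B" for t t'
      using key that by fastforce
    then have "(w - z, z') \<in> B"
      using not_in_graphE[OF B] by (metis not_less_iff_gr_or_eq)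
    from pos[OF this] show False
      by (simp add: blinfun.bilinear_simps)
  qed
  moreover have "(w - z, z') \<in> B"
  proof (rule ccontr)
    assume "(w - z, z') \<notin> B"
    then obtain t t' where "(t, t') \<in> B" "blinfun_apply (z' - t') (w - z - t) < 0"
      by (rule not_in_graphE[OF B])
    with key[OF \<open>(z, z') \<in> A\<close>] show False
      by (fastforce simp: blinfun.bilinear_simps)
  qed
  ultimately show ?thesis
    by blast
qed

text \<open>The same argument with the functional reflected in place of the point: \<open>K\<close>
  now comes from the Fitzpatrick function of \<open>B\<close> at \<open>(y, v' - y')\<close> minus
  \<open>blinfun_apply v' y\<close>.\<close>

lemma graph_meets_dual_reflection:
  fixes A B :: "('a::banach \<times> ('a \<Rightarrow>\<^sub>L real)) set"
  assumes refl: "reflexive_space TYPE('a)"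
    and A: "max_monotone_graph A" and B: "max_monotone_graph B"
    and domA: "\<And>x. \<exists>r. ((x, w'), r) \<in> fitz_epi A"
    and domB: "\<And>x'. \<exists>x r. ((x, x'), r) \<in> fitz_epi B"
  shows "\<exists>z z'. (z, z') \<in> A \<and> (z, v' - z') \<in> B"
proof -
  define \<sigma> where "\<sigma> q = ((fst (fst q), - snd (fst q)), snd q + blinfun_apply v' (fst (fst q)))"
    for q :: "('a \<times> ('a \<Rightarrow>\<^sub>L real)) \<times> real"
  define K where "K = {((y, y'), s). ((y, v' - y'), s + blinfun_apply v' y) \<in> fitz_epi B}"
  have lin: "linear \<sigma>"
    by (rule linearI) (auto simp: \<sigma>_def blinfun.bilinear_simps algebra_simps)
  have cont: "continuous_on UNIV \<sigma>"
    unfolding \<sigma>_def by (intro continuous_intros)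
  have K_eq: "K = \<sigma> -` ((\<lambda>q. ((0, v'), 0) + q) -` fitz_epi B)"
    by (auto simp: K_def \<sigma>_def)
  have convK: "convex K"
    unfolding K_eq
    by (intro convex_linear_vimage lin convex_translation_vimage convex_fitz_epi)
  have closK: "closed K"
    unfolding K_eq
    by (intro closed_vimage closed_fitz_epi cont continuous_intros)
  have domK: "\<exists>x x' r y y' s. ((x, x'), r) \<in> fitz_epi A \<and> ((y, y'), s) \<in> K \<and> u = x - y \<and> u' = x' - y'"
    for u u'
  proof -
    \<comment> \<open>Chosen so that the reflection \<open>y' \<mapsto> v' - y'\<close> turns this
      functional into \<open>w' - u'\<close>, at distance \<open>u'\<close> from the pinned
      \<open>w'\<close>.\<close>
    obtain b s where b: "((b, v' - (w' - u')), s) \<in> fitz_epi B"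
      using domB by blast
    obtain r where "((u + b, w'), r) \<in> fitz_epi A"
      using domA by blast
    moreover have "((b, w' - u'), s - blinfun_apply v' b) \<in> K"
      using b by (simp add: K_def)
    ultimately show ?thesis
      by (intro exI conjI) (assumption | simp)+
  qed
  have posK: "0 \<le> r + s" if "((x, x'), r) \<in> fitz_epi A" "((x, x'), s) \<in> K" for x x' r s
    using fitz_epi_ge[OF A that(1)] fitz_epi_ge[OF B, of x "v' - x'" "s + blinfun_apply v' x"] that(2)
    by (simp add: K_def blinfun.bilinear_simps)
  obtain z z' where z: "\<And>x x' r y y' s. ((x, x'), r) \<in> fitz_epi A \<Longrightarrow> ((y, y'), s) \<in> K \<Longrightarrow>
      blinfun_apply z' (x - y) + blinfun_apply (x' - y') z \<le> r + s"
    by (rule reflexive_fenchel_duality[OF refl convex_fitz_epi closed_fitz_epi convK closK domK])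
      (erule (1) posK, rule that, blast)
  have key: "0 \<le> blinfun_apply (z' - s') (z - s) + blinfun_apply (v' - z' - t') (z - t)"
    if "(s, s') \<in> A" "(t, t') \<in> B" for s s' t t'
  proof -
    have "((t, v' - t'), blinfun_apply t' t - blinfun_apply v' t) \<in> K"
      using graph_in_fitz_epi[OF B that(2)] by (simp add: K_def)
    from z[OF graph_in_fitz_epi[OF A that(1)] this] show ?thesis
      by (simp add: blinfun.bilinear_simps)
  qed
  have "(z, z') \<in> A"
  proof (rule ccontr)
    assume "(z, z') \<notin> A"
    then obtain s s' where s: "(s, s') \<in> A" "blinfun_apply (z' - s') (z - s) < 0"
      by (rule not_in_graphE[OF A])
    then have pos: "0 < blinfun_apply (v' - z' - t') (z - t)" if "(t, t') \<in> B" for t t'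
      using key that by fastforce
    then have "(z, v' - z') \<in> B"
      using not_in_graphE[OF B] by (metis not_less_iff_gr_or_eq)
    from pos[OF this] show False
      by (simp add: blinfun.bilinear_simps)
  qed
  moreover have "(z, v' - z') \<in> B"
  proof (rule ccontr)
    assume "(z, v' - z') \<notin> B"
    then obtain t t' where "(t, t') \<in> B" "blinfun_apply (v' - z' - t') (z - t) < 0"
      by (rule not_in_graphE[OF B])
    with key[OF \<open>(z, z') \<in> A\<close>] show False
      by (fastforce simp: blinfun.bilinear_simps)
  qed
  ultimately show ?thesis
    by blast
qed

section \<open>Surjectivity for the two compositions\<close>

theorem theorem7p5:
  fixes S :: "'a::banach \<Rightarrow> ('a \<Rightarrow>\<^sub>L real) set"
    and T :: "('a \<Rightarrow>\<^sub>L real) \<Rightarrow> 'a set"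
  assumes refl: "reflexive_space TYPE('a)"
    and nonzero: "\<exists>x::'a. x \<noteq> 0"
    and maxS: "maximal_monotoneS S"
    and maxT: "maximal_monotoneT T"
    and domT: "fst ` domT T = UNIV"
    and domS: "\<exists>w'. UNIV \<times> {w'} \<subseteq> domS S"
  shows "((\<Union>x. (\<lambda>z. x + z) ` compTS T S x) = UNIV \<and>
         (\<Union>x'. (\<lambda>z'. x' + z') ` compST S T x') = UNIV)"
proof -
  obtain w' where w': "UNIV \<times> {w'} \<subseteq> domS S"
    using domS by blast
  have dS: "\<exists>r. ((x, w'), r) \<in> fitz_epi (graphS S)" for x
  proof -
    have "(x, w') \<in> domS S"
      using w' by blast
    then show ?thesis
      unfolding fitz_epiS_iff by (intro finite_ereal_le) (simp add: domS_def)
  qed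
  have dT: "\<exists>x r. ((x, x'), r) \<in> fitz_epi ((graphT T)\<inverse>)" for x'
  proof -
    obtain x where "(x', x) \<in> domT T"
      using domT by (metis UNIV_I imageE prod.collapse)
    then show ?thesis
      unfolding fitz_epiT_iff by (intro exI[of _ x] finite_ereal_le) (simp add: domT_def)
  qed
  note graphs = max_monotone_graphS[OF maxS] max_monotone_graphT[OF maxT]
  have "w \<in> (\<Union>x. (\<lambda>z. x + z) ` compTS T S x)" for w
  proof -
    obtain z z' where "z' \<in> S z" "w - z \<in> T z'"
      using graph_meets_reflection[OF refl graphs dS dT, of w] by (auto simp: graphS_def graphT_def)
    then have "w - z \<in> compTS T S z"
      by (auto simp: compTS_def)
    then show ?thesis
      by (metis UNIV_I UN_I add_diff_cancel_left' diff_add_cancel add.commute image_eqI)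
  qed
  moreover have "v' \<in> (\<Union>x'. (\<lambda>z'. x' + z') ` compST S T x')" for v'
  proof -
    \<comment> \<open>The base point is \<open>v' - z'\<close>: its image under \<open>T\<close>
      contains \<open>z\<close>, whose image under \<open>S\<close> contains the summand
      \<open>z'\<close>.\<close>
    obtain z z' where "z' \<in> S z" "z \<in> T (v' - z')"
      using graph_meets_dual_reflection[OF refl graphs dS dT, of v'] by (auto simp: graphS_def graphT_def)
    then have "z' \<in> compST S T (v' - z')"
      by (auto simp: compST_def)
    then show ?thesis
      by (metis UNIV_I UN_I diff_add_cancel image_eqI)
  qed
  ultimately show ?thesis
    by blast
qed

end
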